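(* For any virtual link diagram $D$, the parallel diagram $\phi_+(D)$ admits a mod-$2$ Alexander numbering. Thus, the welded link represented by $\phi_+(D)$ is checkerboard colorable.
   Context: **Diagrams.** A virtual link diagram is a generic immersion of finitely many oriented circles in the plane (considered up to planar isotopy) whose double points are transverse and each marked either as a classical crossing (with over/under information) or as a virtual crossing (no over/under information). A classical crossing is positive if the direction of the over strand is carried to the direction of the under strand by a counterclockwise rotation through an angle less than $\pi$, and negative otherwise. **Welded equivalence.** Two virtual link diagrams are equivalent as welded links if they are related by a finite sequence of planar isotopies and the following local moves (with all orientations): the classical Reidemeister moves I, II, III; the virtual Reidemeister moves, namely the moves I, II, III with all crossings virtual, and the mixed move IV in which a strand meeting two other strands only in virtual crossings is moved across a classical crossing of those two strands; and the welded move, in which a strand passing over (by two classical crossings) two other strands that cross each other virtually is moved across that virtual crossing, remaining over both strands. A welded link is an equivalence class of virtual link diagrams under this relation. **The parallel diagram $\phi_+(D)$.** Given a virtual link diagram $D$, replace every strand $s$ of $D$ by two parallel copies, $s_{\rm R}$ on the right and $s_{\rm L}$ on the left of $s$ (with respect to the orientation of $D$). The crossings are as follows. - At a virtual crossing of $D$, all four resulting crossings are virtual. - At a classical crossing of $D$ with over strand $o$ and under strand $u$: $o_{\rm R}$ and $u_{\rm R}$ cross classically with $o_{\rm R}$ over $u_{\rm R}$; $o_{\rm R}$ and $u_{\rm L}$ cross classically with $o_{\rm R}$ over $u_{\rm L}$; the crossing of $o_{\rm L}$ with $u_{\rm R}$ and that of $o_{\rm L}$ with $u_{\rm L}$ are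 virtual. Moreover a twist is inserted in the pair $(u_{\rm R},u_{\rm L})$ near the crossing. If the crossing of $D$ is positive, then immediately after the crossing along $u$ insert a $-1v$-twist: travelling along $u$, the strands $u_{\rm R},u_{\rm L}$ cross each other first at a classical crossing with $u_{\rm R}$ over $u_{\rm L}$ (a negative crossing when both are oriented parallel to $u$) and then at a virtual crossing, after which $u_{\rm R}$ is again on the right. If the crossing of $D$ is negative, then immediately before the crossing along $u$ insert a $v1$-twist: travelling along $u$, the strands $u_{\rm R},u_{\rm L}$ cross first at a virtual crossing and then at a classical crossing with $u_{\rm R}$ over $u_{\rm L}$ (a positive crossing when both are oriented parallel to $u$). Away from the crossings of $D$ the two copies are just parallel. In $\phi_+(D)$ both copies are oriented parallel to $D$. **Mod-2 Alexander numbering.** Cut a virtual link diagram at all of its classical crossings (both the over and the under strand are cut; virtual crossings are ignored), obtaining a collection of arcs. A mod-$2$ Alexander numbering is an assignment of an element of $\mathbb{Z}/2\mathbb{Z}$ to each arc such that at every classical crossing there is $i\in\mathbb{Z}/2\mathbb{Z}$ with the following property: looking in the common forward direction of the two strands, the two arcs on the right-hand side (incoming right and outgoing right) both receive $i$, and the two arcs on the left-hand side (incoming left and outgoing left) both receive $i+1$. At virtual crossings the number is unchanged along each strand. A welded link is checkerboard colorable (also called mod-$2$ almost classical) if it is represented by some virtual link diagram that admits a mod-$2$ Alexander numbering. *)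

theory Defs
  imports Main "HOL-Library.Z2"
begin

section \<open>Virtual link diagrams\<close>

text \<open>
  Up to planar isotopy, an oriented virtual link diagram can be put in general position with
  respect to the height function of the plane: finitely many critical levels, each carrying
  exactly one local minimum, local maximum or double point, and both strands through a double
  point transverse to the horizontal.  Such a diagram is recorded by the list of its critical
  levels, from bottom to top; planar isotopy becomes the equivalence generated by the rules
  \<open>planar_isotopy\<close> below.

  A slice \<open>(k, e)\<close> is the event \<open>e\<close> with exactly \<open>k\<close> vertical strands to its left.  Between two
  critical levels the diagram is a row of vertical strands, described from left to right by the
  list of their orientations.
\<close>

datatype orientation = Up | Down

fun reverse :: "orientation \<Rightarrow> orientation" where
  "reverse Up = Down"
| "reverse Down = Up"

text \<open>
  At a double point one strand joins south-west and north-east and the other one joins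
  south-east and north-west; the classical crossings are named after their over strand.
\<close>

datatype crossing = Over_SW_NE | Over_SE_NW | Virtual

text \<open>\<open>Cup d\<close> is a local minimum whose left branch has orientation \<open>d\<close>.\<close>

datatype event = Cup orientation | Cap | Cross crossing

type_synonym slice = "nat \<times> event"

fun pass_slice :: "orientation list \<Rightarrow> slice \<Rightarrow> orientation list option" where
  "pass_slice w (k, Cup d) =
     (if k \<le> length w then Some (take k w @ [d, reverse d] @ drop k w) else None)"
| "pass_slice w (k, Cap) =
     (if k + 1 < length w \<and> w ! (k + 1) = reverse (w ! k)
      then Some (take k w @ drop (k + 2) w) else None)"
| "pass_slice w (k, Cross c) =
     (if k + 1 < length w
      then Some (take k w @ [w ! (k + 1), w ! k] @ drop (k + 2) w) else None)"

fun pass_slices :: "orientation list \<Rightarrow> slice list \<Rightarrow> orientation list option" where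
  "pass_slices w [] = Some w"
| "pass_slices w (l # s) =
     (case pass_slice w l of None \<Rightarrow> None | Some w' \<Rightarrow> pass_slices w' s)"

typedef virtual_link_diagram = "{s. pass_slices [] s = Some []}"
  morphisms slices Diagram
  by (rule exI[of _ "[]"]) simp

setup_lifting type_definition_virtual_link_diagram

definition level :: "virtual_link_diagram \<Rightarrow> nat \<Rightarrow> orientation list" where
  "level D t = the (pass_slices [] (take t (slices D)))"


section \<open>Signs and sides at a double point\<close>

text \<open>
  Tangent vectors at a double point, \<open>a\<close> and \<open>b\<close> being the orientations of the strand through
  south-west and of the strand through south-east.
\<close>

definition tangent_SW_NE :: "orientation \<Rightarrow> int \<times> int" where
  "tangent_SW_NE a = (if a = Up then (1, 1) else (-1, -1))"

definition tangent_SE_NW :: "orientation \<Rightarrow> int \<times> int" where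
  "tangent_SE_NW b = (if b = Up then (-1, 1) else (1, -1))"

text \<open>
  \<open>det2 v w\<close> is positive iff a counterclockwise rotation through an angle in \<open>(0, \<pi>)\<close> carries
  the direction of \<open>v\<close> to that of \<open>w\<close>, i.e. iff \<open>w\<close> points to the left of \<open>v\<close>.
\<close>

definition det2 :: "int \<times> int \<Rightarrow> int \<times> int \<Rightarrow> int" where
  "det2 v w = fst v * snd w - snd v * fst w"

fun positive_crossing :: "orientation \<Rightarrow> orientation \<Rightarrow> crossing \<Rightarrow> bool" where
  "positive_crossing a b Over_SW_NE \<longleftrightarrow> det2 (tangent_SW_NE a) (tangent_SE_NW b) > 0"
| "positive_crossing a b Over_SE_NW \<longleftrightarrow> det2 (tangent_SE_NW b) (tangent_SW_NE a) > 0"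
| "positive_crossing a b Virtual \<longleftrightarrow> False"

definition forward_direction :: "orientation \<Rightarrow> orientation \<Rightarrow> int \<times> int" where
  "forward_direction a b =
     (fst (tangent_SW_NE a) + fst (tangent_SE_NW b), snd (tangent_SW_NE a) + snd (tangent_SE_NW b))"


section \<open>Welded links\<close>

text \<open>
  The crossing type with the same over strand when the strand running from south-west to
  north-east and the strand running from south-east to north-west exchange their roles.
\<close>

fun exchange :: "crossing \<Rightarrow> crossing" where
  "exchange Over_SW_NE = Over_SE_NW"
| "exchange Over_SE_NW = Over_SW_NE"
| "exchange Virtual = Virtual"

fun width_below :: "event \<Rightarrow> nat" where
  "width_below (Cup d) = 0"
| "width_below Cap = 2"
| "width_below (Cross c) = 2"

fun width_above :: "event \<Rightarrow> nat" where
  "width_above (Cup d) = 2"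
| "width_above Cap = 0"
| "width_above (Cross c) = 2"

text \<open>
  Planar isotopy of diagrams in general position: critical levels at disjoint places exchange
  their heights, a maximum and a minimum on the same strand cancel, and a double point slides
  through a maximum or a minimum of one of its two strands.
\<close>

inductive planar_isotopy :: "slice list \<Rightarrow> slice list \<Rightarrow> bool" where
  height_exchange:
    "planar_isotopy [(k, e), (k + width_above e + m, f)] [(k + width_below e + m, f), (k, e)]"
| cancel_left: "planar_isotopy [(k, Cup d), (k + 1, Cap)] []"
| cancel_right: "planar_isotopy [(k + 1, Cup d), (k, Cap)] []"
| slide_maximum:
    "planar_isotopy [(k + 1, Cross c), (k, Cap)] [(k, Cross (exchange c)), (k + 1, Cap)]"
| slide_minimum:
    "planar_isotopy [(k, Cup d), (k + 1, Cross c)] [(k + 1, Cup d), (k, Cross (exchange c))]"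

text \<open>
  The other moves are local too, and it suffices to list each of them in one position: every
  other one is obtained by rotating the disc of the move, which is a planar isotopy.  The
  orientations of the strands are those imposed by the surrounding diagram.  The
  first and second moves are classical or virtual according to the crossing type \<open>c\<close>.
\<close>

inductive move_I :: "slice list \<Rightarrow> slice list \<Rightarrow> bool" where
  kink_right: "move_I [(k + 1, Cup d), (k, Cross c), (k + 1, Cap)] []"
| kink_left: "move_I [(k, Cup d), (k + 1, Cross c), (k, Cap)] []"

inductive move_II :: "slice list \<Rightarrow> slice list \<Rightarrow> bool" where
  "move_II [(k, Cross c), (k, Cross (exchange c))] []"

text \<open>
  A move of type III involves three strands 1, 2, 3, numbered from left to right at the bottom.
  In the two pictures below \<open>c12\<close>, \<open>c13\<close>, \<open>c23\<close> are the crossings of the indicated pairs, and in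
  each of them the strand with the smaller number runs from south-west to north-east.
\<close>

definition triangle_before :: "nat \<Rightarrow> crossing \<Rightarrow> crossing \<Rightarrow> crossing \<Rightarrow> slice list" where
  "triangle_before k c12 c13 c23 = [(k, Cross c12), (k + 1, Cross c13), (k, Cross c23)]"

definition triangle_after :: "nat \<Rightarrow> crossing \<Rightarrow> crossing \<Rightarrow> crossing \<Rightarrow> slice list" where
  "triangle_after k c12 c13 c23 = [(k + 1, Cross c23), (k, Cross c13), (k + 1, Cross c12)]"

text \<open>
  The two excluded assignments in the classical case are 1 over 2 over 3 over 1 and
  1 under 2 under 3 under 1, for which no strand lies over (or under) the two others.
\<close>

inductive classical_III :: "crossing \<Rightarrow> crossing \<Rightarrow> crossing \<Rightarrow> bool" where
  "c12 \<noteq> Virtual \<Longrightarrow> c13 \<noteq> Virtual \<Longrightarrow> c23 \<noteq> Virtual \<Longrightarrow>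
   \<not> (c12 = Over_SW_NE \<and> c23 = Over_SW_NE \<and> c13 = Over_SE_NW) \<Longrightarrow>
   \<not> (c12 = Over_SE_NW \<and> c23 = Over_SE_NW \<and> c13 = Over_SW_NE) \<Longrightarrow>
   classical_III c12 c13 c23"

inductive virtual_III :: "crossing \<Rightarrow> crossing \<Rightarrow> crossing \<Rightarrow> bool" where
  "virtual_III Virtual Virtual Virtual"

inductive mixed_IV :: "crossing \<Rightarrow> crossing \<Rightarrow> crossing \<Rightarrow> bool" where
  virtual_strand_1: "c \<noteq> Virtual \<Longrightarrow> mixed_IV Virtual Virtual c"
| virtual_strand_2: "c \<noteq> Virtual \<Longrightarrow> mixed_IV Virtual c Virtual"
| virtual_strand_3: "c \<noteq> Virtual \<Longrightarrow> mixed_IV c Virtual Virtual"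

inductive welded_III :: "crossing \<Rightarrow> crossing \<Rightarrow> crossing \<Rightarrow> bool" where
  over_strand_1: "welded_III Over_SW_NE Over_SW_NE Virtual"
| over_strand_2: "welded_III Over_SE_NW Virtual Over_SW_NE"
| over_strand_3: "welded_III Virtual Over_SE_NW Over_SE_NW"

inductive move_III :: "slice list \<Rightarrow> slice list \<Rightarrow> bool" where
  "classical_III c12 c13 c23 \<or> virtual_III c12 c13 c23 \<or> mixed_IV c12 c13 c23 \<or>
     welded_III c12 c13 c23 \<Longrightarrow>
   move_III (triangle_before k c12 c13 c23) (triangle_after k c12 c13 c23)"

definition welded_move :: "virtual_link_diagram \<Rightarrow> virtual_link_diagram \<Rightarrow> bool" where
  "welded_move D D' \<longleftrightarrow>
     (\<exists>below above s s'. slices D = below @ s @ above \<and> slices D' = below @ s' @ above \<and>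
        (planar_isotopy s s' \<or> move_I s s' \<or> move_II s s' \<or> move_III s s'))"

definition welded_equivalent :: "virtual_link_diagram \<Rightarrow> virtual_link_diagram \<Rightarrow> bool" where
  "welded_equivalent = equivclp welded_move"

quotient_type welded_link = virtual_link_diagram / welded_equivalent
  morphisms rep_welded_link welded_link_of
  unfolding welded_equivalent_def by (rule equivp_evquivclp)


section \<open>Mod-2 Alexander numberings\<close>

text \<open>
  The point \<open>(t, p)\<close> lies on the \<open>p\<close>-th strand just below the critical level number \<open>t\<close>.
\<close>

definition points :: "virtual_link_diagram \<Rightarrow> (nat \<times> nat) set" where
  "points D = {(t, p). t \<le> length (slices D) \<and> p < length (level D t)}"

text \<open>
  \<open>joined D x y\<close>: the points \<open>x\<close> and \<open>y\<close> are connected by a piece of strand inside a single slice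
  which is not cut, the strands being cut at the classical crossings only.
\<close>

inductive joined :: "virtual_link_diagram \<Rightarrow> nat \<times> nat \<Rightarrow> nat \<times> nat \<Rightarrow> bool"
  for D :: virtual_link_diagram where
  strand_left: "t < length (slices D) \<Longrightarrow> slices D ! t = (k, e) \<Longrightarrow> p < k \<Longrightarrow>
    joined D (t, p) (t + 1, p)"
| strand_right: "t < length (slices D) \<Longrightarrow> slices D ! t = (k, e) \<Longrightarrow>
    k + width_below e + p < length (level D t) \<Longrightarrow>
    joined D (t, k + width_below e + p) (t + 1, k + width_above e + p)"
| minimum: "t < length (slices D) \<Longrightarrow> slices D ! t = (k, Cup d) \<Longrightarrow>
    joined D (t + 1, k) (t + 1, k + 1)"
| maximum: "t < length (slices D) \<Longrightarrow> slices D ! t = (k, Cap) \<Longrightarrow>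
    joined D (t, k) (t, k + 1)"
| virtual_SW_NE: "t < length (slices D) \<Longrightarrow> slices D ! t = (k, Cross Virtual) \<Longrightarrow>
    joined D (t, k) (t + 1, k + 1)"
| virtual_SE_NW: "t < length (slices D) \<Longrightarrow> slices D ! t = (k, Cross Virtual) \<Longrightarrow>
    joined D (t, k + 1) (t + 1, k)"

definition same_arc :: "virtual_link_diagram \<Rightarrow> ((nat \<times> nat) \<times> (nat \<times> nat)) set" where
  "same_arc D = {(x, y). x \<in> points D \<and> y \<in> points D \<and> equivclp (joined D) x y}"

definition arcs :: "virtual_link_diagram \<Rightarrow> (nat \<times> nat) set set" where
  "arcs D = points D // same_arc D"

definition arc_through :: "virtual_link_diagram \<Rightarrow> nat \<times> nat \<Rightarrow> (nat \<times> nat) set" where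
  "arc_through D x = same_arc D `` {x}"

text \<open>
  The four arc ends at a double point, situated in slice number \<open>t\<close> and having \<open>k\<close> strands to its
  left, each with the vector
  pointing to it from the double point.
\<close>

definition arc_ends :: "nat \<Rightarrow> nat \<Rightarrow> ((int \<times> int) \<times> (nat \<times> nat)) set" where
  "arc_ends t k =
     {((-1, -1), (t, k)), ((1, -1), (t, k + 1)), ((-1, 1), (t + 1, k)), ((1, 1), (t + 1, k + 1))}"

text \<open>Only the values on \<open>arcs D\<close> matter.  The type \<open>bit\<close> is the field with two elements.\<close>

definition mod2_alexander_numbering ::
    "virtual_link_diagram \<Rightarrow> ((nat \<times> nat) set \<Rightarrow> bit) \<Rightarrow> bool" where
  "mod2_alexander_numbering D \<nu> \<longleftrightarrow>
     (\<forall>t k c. t < length (slices D) \<longrightarrow> slices D ! t = (k, Cross c) \<longrightarrow> c \<noteq> Virtual \<longrightarrow>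
        (\<exists>i. \<forall>(v, x) \<in> arc_ends t k.
           \<nu> (arc_through D x) =
             (if det2 (forward_direction (level D t ! k) (level D t ! (k + 1))) v < 0
              then i else i + 1)))"

definition admits_mod2_alexander_numbering :: "virtual_link_diagram \<Rightarrow> bool" where
  "admits_mod2_alexander_numbering D \<longleftrightarrow> (\<exists>\<nu>. mod2_alexander_numbering D \<nu>)"

definition checkerboard_colorable :: "welded_link \<Rightarrow> bool" where
  "checkerboard_colorable L \<longleftrightarrow>
     (\<exists>D. welded_link_of D = L \<and> admits_mod2_alexander_numbering D)"


section \<open>The parallel diagram\<close>

text \<open>
  The copies of the strand at position \<open>p\<close> occupy the positions \<open>2 * p\<close> and \<open>2 * p + 1\<close>; the right
  copy is the eastern one if the strand is oriented upwards and the western one otherwise.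
  Below, \<open>a\<close> and \<open>b\<close> are the orientations of the strands entering the double point from
  south-west and from south-east.  The four double points replacing it are, in this order, those
  of the eastern copy of the first strand with the western copy of the second one,
  western with western, eastern with eastern, and western with eastern.
\<close>

definition copy_crossing :: "crossing \<Rightarrow> bool \<Rightarrow> bool \<Rightarrow> crossing" where
  "copy_crossing c a_right b_right =
     (case c of
        Over_SW_NE \<Rightarrow> if a_right then Over_SW_NE else Virtual
      | Over_SE_NW \<Rightarrow> if b_right then Over_SE_NW else Virtual
      | Virtual \<Rightarrow> Virtual)"

definition doubled_crossing :: "nat \<Rightarrow> orientation \<Rightarrow> orientation \<Rightarrow> crossing \<Rightarrow> slice list" where
  "doubled_crossing k a b c =
     [(2 * k + 1, Cross (copy_crossing c (a = Up) (b = Down))),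
      (2 * k, Cross (copy_crossing c (a = Down) (b = Down))),
      (2 * k + 2, Cross (copy_crossing c (a = Up) (b = Up))),
      (2 * k + 1, Cross (copy_crossing c (a = Down) (b = Up)))]"

text \<open>
  The \<open>-1v\<close>-twist and the \<open>v1\<close>-twist in the pair of strands at positions \<open>p\<close>, \<open>p + 1\<close>, both with
  the given orientation.  Slices are listed from bottom to top, hence against the direction of
  travel for \<open>Down\<close>.
\<close>

fun twist_minus1_v :: "nat \<Rightarrow> orientation \<Rightarrow> slice list" where
  "twist_minus1_v p Up = [(p, Cross Over_SE_NW), (p, Cross Virtual)]"
| "twist_minus1_v p Down = [(p, Cross Virtual), (p, Cross Over_SE_NW)]"

fun twist_v_1 :: "nat \<Rightarrow> orientation \<Rightarrow> slice list" where
  "twist_v_1 p Up = [(p, Cross Virtual), (p, Cross Over_SW_NE)]"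
| "twist_v_1 p Down = [(p, Cross Over_SW_NE), (p, Cross Virtual)]"

text \<open>
  For a classical crossing, \<open>u\<close> is the orientation of the under strand and \<open>below\<close>, \<open>above\<close> are
  the positions of its two copies below and above the crossing.  For \<open>u = Up\<close> the part of the
  under strand after the crossing is the one above it, for \<open>u = Down\<close> the one below it.
\<close>

definition parallel_crossing :: "nat \<Rightarrow> orientation \<Rightarrow> orientation \<Rightarrow> crossing \<Rightarrow> slice list" where
  "parallel_crossing k a b c =
     (if c = Virtual then doubled_crossing k a b c
      else
        (let (u, below, above) =
               (if c = Over_SW_NE then (b, 2 * k + 2, 2 * k) else (a, 2 * k, 2 * k + 2))
         in if positive_crossing a b c then
              (if u = Up then doubled_crossing k a b c @ twist_minus1_v above u
               else twist_minus1_v below u @ doubled_crossing k a b c)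
            else
              (if u = Up then twist_v_1 below u @ doubled_crossing k a b c
               else doubled_crossing k a b c @ twist_v_1 above u)))"

fun parallel_slice :: "orientation list \<Rightarrow> slice \<Rightarrow> slice list" where
  "parallel_slice w (k, Cup d) = [(2 * k, Cup d), (2 * k + 1, Cup d)]"
| "parallel_slice w (k, Cap) = [(2 * k + 1, Cap), (2 * k, Cap)]"
| "parallel_slice w (k, Cross c) = parallel_crossing k (w ! k) (w ! (k + 1)) c"

fun parallel_slices :: "orientation list \<Rightarrow> slice list \<Rightarrow> slice list" where
  "parallel_slices w [] = []"
| "parallel_slices w (l # s) =
     parallel_slice w l @ parallel_slices (the (pass_slice w l)) s"

definition doubled :: "orientation list \<Rightarrow> orientation list" where
  "doubled w = concat (map (\<lambda>d. [d, d]) w)"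

lemma doubled_simps:
  "doubled [] = []" "doubled (d # w) = d # d # doubled w" "doubled (v @ w) = doubled v @ doubled w"
  "length (doubled w) = 2 * length w"
  by (induction w) (simp_all add: doubled_def)

lemma pass_slices_append:
  "pass_slices w (s @ s') =
     (case pass_slices w s of None \<Rightarrow> None | Some w' \<Rightarrow> pass_slices w' s')"
  by (induction w s rule: pass_slices.induct) (auto split: option.splits)

lemma pass_Cup_at:
  "n = length xs \<Longrightarrow> pass_slice (xs @ ys) (n, Cup d) = Some (xs @ [d, reverse d] @ ys)"
  by simp

lemma pass_Cap_at:
  "n = length xs \<Longrightarrow> b = reverse a \<Longrightarrow> pass_slice (xs @ a # b # ys) (n, Cap) = Some (xs @ ys)"
  by (simp add: nth_append)

lemma pass_Cross_at:
  "n = length xs \<Longrightarrow> pass_slice (xs @ a # b # ys) (n, Cross c) = Some (xs @ b # a # ys)"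
  by (simp add: nth_append)

lemma pass_doubled_crossing:
  assumes "k = length xs"
  shows "pass_slices (doubled xs @ a # a # b # b # ys) (doubled_crossing k a b c) =
    Some (doubled xs @ b # b # a # a # ys)"
  using pass_Cross_at[of "2 * k + 1" "doubled xs @ [a]" a b "b # ys"]
    pass_Cross_at[of "2 * k" "doubled xs" a b "a # b # ys"]
    pass_Cross_at[of "2 * k + 2" "doubled xs @ [b, a]" a b "ys"]
    pass_Cross_at[of "2 * k + 1" "doubled xs @ [b]" a b "a # ys"] assms
  by (simp add: doubled_crossing_def doubled_simps del: pass_slice.simps)

lemma pass_twist:
  assumes "p = length xs"
  shows "pass_slices (xs @ u # u # ys) (twist_minus1_v p u) = Some (xs @ u # u # ys)"
    and "pass_slices (xs @ u # u # ys) (twist_v_1 p u) = Some (xs @ u # u # ys)"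
  using pass_Cross_at[OF assms, of u u ys]
  by (cases u; simp del: pass_slice.simps)+

lemma pass_parallel_crossing:
  assumes "k = length xs"
  shows "pass_slices (doubled xs @ a # a # b # b # ys) (parallel_crossing k a b c) =
    Some (doubled xs @ b # b # a # a # ys)"
proof -
  note tw =
    pass_twist[of "2 * k" "doubled xs" a "b # b # ys"]
    pass_twist[of "2 * k" "doubled xs" b "a # a # ys"]
    pass_twist[of "2 * k + 2" "doubled xs @ [a, a]" b ys]
    pass_twist[of "2 * k + 2" "doubled xs @ [b, b]" a ys]
  show ?thesis
    using tw pass_doubled_crossing[OF assms, of a b ys c] assms
    by (auto simp: parallel_crossing_def pass_slices_append doubled_simps Let_def
        simp del: pass_slice.simps twist_minus1_v.simps twist_v_1.simps)
qed

lemma pass_parallel_slice: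
  assumes "pass_slice w l = Some w'"
  shows "pass_slices (doubled w) (parallel_slice w l) = Some (doubled w')"
proof -
  obtain k e where l: "l = (k, e)" by (cases l)
  have two: "\<exists>xs a b ys. w = xs @ a # b # ys \<and> length xs = k" if "k + 1 < length w"
    using that
    by (intro exI[of _ "take k w"] exI[of _ "w ! k"] exI[of _ "w ! (k + 1)"] exI[of _ "drop (k + 2) w"])
       (simp add: Cons_nth_drop_Suc)
  show ?thesis
  proof (cases e)
    case (Cup d)
    define xs ys where "xs = take k w" and "ys = drop k w"
    have k: "k = length xs" and w: "w = xs @ ys" and w': "w' = xs @ [d, reverse d] @ ys"
      using assms by (auto simp: l Cup xs_def ys_def split: if_splits)
    show ?thesis
      using pass_Cup_at[of "2 * k" "doubled xs" "doubled ys" d]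
        pass_Cup_at[of "2 * k + 1" "doubled xs @ [d]" "reverse d # doubled ys" d] k
      by (simp add: l Cup w w' doubled_simps del: pass_slice.simps)
  next
    case Cap
    with assms l two obtain xs a b ys
      where w: "w = xs @ a # b # ys" and k: "length xs = k"
      by (auto split: if_splits)
    have b: "b = reverse a" and w': "w' = xs @ ys"
      using assms by (auto simp: l Cap w k[symmetric] nth_append split: if_splits)
    show ?thesis
      using pass_Cap_at[of "2 * k + 1" "doubled xs @ [a]" b a "b # doubled ys"]
        pass_Cap_at[of "2 * k" "doubled xs" b a "doubled ys"] k b
      by (simp add: l Cap w w' doubled_simps del: pass_slice.simps)
  next
    case (Cross c)
    with assms l two obtain xs a b ys
      where w: "w = xs @ a # b # ys" and k: "length xs = k"
      by (auto split: if_splits)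
    have w': "w' = xs @ b # a # ys"
      using assms by (auto simp: l Cross w k[symmetric] nth_append split: if_splits)
    show ?thesis
      using pass_parallel_crossing[of k xs a b "doubled ys" c] k
      by (simp add: l Cross w w' doubled_simps nth_append)
  qed
qed

lemma pass_parallel_slices:
  "pass_slices w s = Some w' \<Longrightarrow>
   pass_slices (doubled w) (parallel_slices w s) = Some (doubled w')"
  by (induction w s rule: pass_slices.induct)
     (auto simp: pass_slices_append pass_parallel_slice split: option.splits)

lift_definition phi_plus :: "virtual_link_diagram \<Rightarrow> virtual_link_diagram"
  is "parallel_slices []"
  using pass_parallel_slices[of "[]" _ "[]"] by (simp add: doubled_simps)

end

theory Submission
  imports Defs
begin

text \<open>
  In \<open>\<phi>\<^sub>+(D)\<close> give the number 1 to every right copy and 0 to every left copy.  The strand \<open>o\<^sub>R\<close>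
  passes over both copies of the under strand, so its number changes twice; the number of each
  copy of the under strand changes once below \<open>o\<^sub>R\<close> and once in the twist.

  Adding 1 to the numbers of the downward strands removes the orientations from the problem:
  the numbers on a level become a word of bits that alternates along every minimum and
  maximum, has different letters at the two feet of every classical crossing and is left
  unchanged by it, and is permuted by the virtual crossings.  Between the critical levels of \<open>D\<close>
  the word for \<open>\<phi>\<^sub>+(D)\<close> is simply \<open>0101\<dots>01\<close>.
\<close>

fun recolor :: "bit list \<Rightarrow> slice \<Rightarrow> bit list \<Rightarrow> bool" where
  "recolor v (k, Cup d) v' \<longleftrightarrow>
     k \<le> length v \<and> (\<exists>i. v' = take k v @ [i, i + 1] @ drop k v)"
| "recolor v (k, Cap) v' \<longleftrightarrow>
     k + 1 < length v \<and> v ! (k + 1) = v ! k + 1 \<and> v' = take k v @ drop (k + 2) v"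
| "recolor v (k, Cross c) v' \<longleftrightarrow>
     k + 1 < length v \<and>
     (if c = Virtual then v' = take k v @ [v ! (k + 1), v ! k] @ drop (k + 2) v
      else v ! (k + 1) = v ! k + 1 \<and> v' = v)"

fun recolors :: "bit list \<Rightarrow> slice list \<Rightarrow> bit list \<Rightarrow> bool" where
  "recolors v [] v' \<longleftrightarrow> v' = v"
| "recolors v (l # s) v' \<longleftrightarrow> (\<exists>u. recolor v l u \<and> recolors u s v')"

lemma recolors_append:
  "recolors v (s @ s') v' \<longleftrightarrow> (\<exists>u. recolors v s u \<and> recolors u s' v')"
  by (induction s arbitrary: v) auto

text \<open>The intermediate words hidden in the existentials of \<open>recolors\<close> become a
  function of the level, from which point values can be read off.\<close>

lemma recolors_sequence:
  assumes "recolors v s v'"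
  obtains c where "c 0 = v" "\<And>t. t < length s \<Longrightarrow> recolor (c t) (s ! t) (c (Suc t))"
proof -
  have "\<exists>c. c 0 = v \<and> (\<forall>t < length s. recolor (c t) (s ! t) (c (Suc t)))"
    using assms
  proof (induction s arbitrary: v)
    case Nil
    show ?case by auto
  next
    case (Cons l s)
    then obtain u where u: "recolor v l u" "recolors u s v'" by auto
    from Cons.IH[OF u(2)] obtain c
      where c: "c 0 = u" "\<forall>t < length s. recolor (c t) (s ! t) (c (Suc t))" by blast
    have "recolor (case_nat v c t) ((l # s) ! t) (case_nat v c (Suc t))"
      if "t < length (l # s)" for t
      using that u(1) c by (cases t) auto
    then show ?case by (intro exI[of _ "case_nat v c"]) simp
  qed
  with that show thesis by blast
qed

text \<open>Since the whole diagram passes, so does each prefix, and the \<open>the\<close> in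
  \<open>level\<close> never meets \<open>None\<close>.\<close>

lemma pass_level:
  assumes "t < length (slices D)"
  shows "pass_slice (level D t) (slices D ! t) = Some (level D (t + 1))"
proof -
  let ?s = "slices D"
  have "pass_slices [] ?s = Some []"
    using slices[of D] by simp
  moreover have "?s = take t ?s @ ?s ! t # drop (Suc t) ?s"
    using assms by (simp add: id_take_nth_drop)
  ultimately have "pass_slices [] (take t ?s @ ?s ! t # drop (Suc t) ?s) = Some []"
    by metis
  moreover have "take (t + 1) ?s = take t ?s @ [?s ! t]"
    using assms by (simp add: take_Suc_conv_app_nth)
  ultimately show ?thesis
    by (auto simp: level_def pass_slices_append split: option.splits)
qed

definition turn :: "orientation \<Rightarrow> bit" where
  "turn d = (if d = Up then 0 else 1)"

lemma turn_reverse: "turn (reverse d) = turn d + 1"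
  by (cases d) (simp_all add: turn_def)

text \<open>Letter plus \<open>turn\<close> recovers the number. At a minimum or maximum both
  summands change between the two branches, so the sum is constant along arcs; elsewhere letter and
  orientation travel together along uncut pieces.\<close>

lemma admits_numbering_if_recolors:
  assumes "recolors [] (slices D) v"
  shows "admits_mod2_alexander_numbering D"
proof -
  obtain c where c: "\<And>t. t < length (slices D) \<Longrightarrow> recolor (c t) (slices D ! t) (c (Suc t))"
    using recolors_sequence[OF assms] by metis
  define f where "f = (\<lambda>(t, p). c t ! p + turn (level D t ! p))"
  have joined: "f x = f y" if "joined D x y" for x y
    using that
  proof cases
    case (strand_left t k e p)
    then show ?thesis using c[of t] pass_level[of t D, symmetric]
      by (cases e) (auto simp: f_def nth_append split: if_splits)
  next
    case (strand_right t k e p)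
    then show ?thesis using c[of t] pass_level[of t D, symmetric]
      by (cases e) (auto simp: f_def nth_append min_def add.commute split: if_splits)
  next
    case (minimum t k d)
    then show ?thesis using c[of t] pass_level[of t D, symmetric]
      by (auto simp: f_def nth_append turn_reverse split: if_splits)
  next
    case (maximum t k)
    then show ?thesis using c[of t] pass_level[of t D, symmetric]
      by (auto simp: f_def turn_reverse split: if_splits)
  next
    case (virtual_SW_NE t k)
    then show ?thesis using c[of t] pass_level[of t D, symmetric]
      by (auto simp: f_def nth_append split: if_splits)
  next
    case (virtual_SE_NW t k)
    then show ?thesis using c[of t] pass_level[of t D, symmetric]
      by (auto simp: f_def nth_append split: if_splits)
  qed
  have equiv: "f x = f y" if "equivclp (joined D) x y" for x y
    using that by (induction rule: equivclp_induct) (auto dest: joined)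
  \<comment> \<open>A numbering takes whole arcs as arguments. Any representative will do, because
    \<open>f\<close> is constant on each arc.\<close>
  define \<nu> where "\<nu> = (\<lambda>A. f (SOME x. x \<in> A))"
  have \<nu>: "\<nu> (arc_through D x) = f x" if "x \<in> points D" for x
  proof -
    have "x \<in> arc_through D x"
      using that by (simp add: arc_through_def same_arc_def)
    then have "(SOME y. y \<in> arc_through D x) \<in> arc_through D x"
      by (rule someI)
    then have "equivclp (joined D) x (SOME y. y \<in> arc_through D x)"
      unfolding arc_through_def same_arc_def by blast
    then show ?thesis
      unfolding \<nu>_def by (rule equiv[symmetric])
  qed
  have "\<exists>i. \<forall>(u, x) \<in> arc_ends t k. \<nu> (arc_through D x) =
      (if det2 (forward_direction (level D t ! k) (level D t ! (k + 1))) u < 0 then i else i + 1)"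
    if t: "t < length (slices D)" and l: "slices D ! t = (k, Cross x)" and x: "x \<noteq> Virtual"
    for t k x
  proof -
    let ?w = "level D t" and ?w' = "level D (t + 1)"
    have k: "k + 1 < length ?w"
      and w': "?w' = take k ?w @ [?w ! (k + 1), ?w ! k] @ drop (k + 2) ?w"
      using pass_level[OF t] by (auto simp: l split: if_splits)
    have points: "(t, k) \<in> points D" "(t, k + 1) \<in> points D"
      "(t + 1, k) \<in> points D" "(t + 1, k + 1) \<in> points D"
      using t k by (auto simp: points_def w' simp del: One_nat_def add_Suc_right)
    have "c (t + 1) = c t" "c t ! (k + 1) = c t ! k + 1"
      using c[OF t] x by (auto simp: l)
    moreover have "?w' ! k = ?w ! (k + 1)" "?w' ! (k + 1) = ?w ! k"
      using k unfolding w' by (auto simp: nth_append)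
    ultimately show ?thesis
      using points
      \<comment> \<open>The witness is the number on the right-hand side: east for two upward
        strands, west for two downward ones, where it is \<open>c t ! k + 1\<close>; south or north
        for opposite orientations, where it is \<open>c t ! k\<close>.\<close>
      by (intro exI[of _ "c t ! k + of_bool (?w ! k = ?w ! (k + 1))"], cases "?w ! k"; cases "?w ! (k + 1)")
        (simp_all add: arc_ends_def \<nu> f_def turn_def det2_def forward_direction_def
          tangent_SW_NE_def tangent_SE_NW_def)
  qed
  then show ?thesis
    unfolding admits_mod2_alexander_numbering_def mod2_alexander_numbering_def by blast
qed

text \<open>West copies carry 0 and east copies 1. Adding \<open>turn\<close> gives 1 on right
  copies and 0 on left ones, whatever the orientation.\<close>

definition alternating :: "nat \<Rightarrow> bit list" where
  "alternating n = concat (replicate n [0, 1])"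

lemma alternating_simps:
  "alternating 0 = []" "alternating (Suc n) = 0 # 1 # alternating n"
  "length (alternating n) = 2 * n"
  by (simp_all add: alternating_def) (induction n; simp)

lemma alternating_add: "alternating (m + n) = alternating m @ alternating n"
  by (simp add: alternating_def replicate_add)

text \<open>With the two feet displayed in the list, simplification can run a concrete word through
  a list of crossings.\<close>

lemma recolor_Cross_at:
  assumes "n = length xs"
  shows "recolor (xs @ i # j # ys) (n, Cross Virtual) v \<longleftrightarrow> v = xs @ j # i # ys"
    and "c \<noteq> Virtual \<Longrightarrow>
      recolor (xs @ i # j # ys) (n, Cross c) v \<longleftrightarrow> j = i + 1 \<and> v = xs @ i # j # ys"
  using assms by (auto simp: nth_append)

text \<open>If \<open>c\<close> is classical, the under pair reads 10 between twist and doubled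
  crossing and 01 elsewhere: the virtual point of the twist swaps its letters, and the doubled
  crossing swaps them once more. This makes the feet differ at all classical points. If
  \<open>c\<close> is virtual, two blocks 01 change places.\<close>

lemma recolors_parallel_crossing:
  assumes "length xs = 2 * k"
  shows "recolors (xs @ 0 # 1 # 0 # 1 # ys) (parallel_crossing k a b c) (xs @ 0 # 1 # 0 # 1 # ys)"
proof -
  note step = recolor_Cross_at[of "2 * k" xs]
    recolor_Cross_at[of "Suc (2 * k)" "xs @ [h]" for h, unfolded append_assoc append.simps]
    recolor_Cross_at[of "Suc (Suc (2 * k))" "xs @ [h, h']" for h h', unfolded append_assoc append.simps]
  show ?thesis
    by (cases a; cases b; cases c)
      (simp_all add: parallel_crossing_def doubled_crossing_def copy_crossing_def step assms
        det2_def tangent_SW_NE_def tangent_SE_NW_def del: recolor.simps)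
qed

lemma recolors_parallel_slice:
  assumes "pass_slice w l = Some w'"
  shows "recolors (alternating (length w)) (parallel_slice w l) (alternating (length w'))"
proof -
  obtain k e where l: "l = (k, e)" by (cases l)
  show ?thesis
  proof (cases e)
    case (Cup d)
    then have "k \<le> length w" and "length w' = k + Suc (Suc (length w - k))"
      using assms by (auto simp: l split: if_splits)
    then obtain n where "length w = k + n" "length w' = k + Suc (Suc n)"
      by (metis le_add_diff_inverse)
    then have w: "alternating (length w) = alternating k @ alternating n"
      and w': "alternating (length w') = alternating k @ 0 # 1 # 0 # 1 # alternating n"
      by (simp_all only: alternating_add alternating_simps)
    show ?thesis
      unfolding w w' l Cup
      by (simp add: alternating_simps)
        \<comment> \<open>The outer minimum inserts 01, and the inner one, starting with 1, inserts
          10 between these letters, giving 0101.\<close>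
        (intro exI[of _ "alternating k @ 0 # 1 # alternating n"] conjI exI[of _ "0::bit"]
          exI[of _ "1::bit"]; simp add: alternating_simps)
  next
    case Cap
    then have "k + 2 \<le> length w" and "length w' = length w - 2"
      using assms by (auto simp: l split: if_splits)
    then obtain n where "length w = k + Suc (Suc n)" "length w' = k + n"
      by (auto simp: le_iff_add)
    then have w: "alternating (length w) = alternating k @ 0 # 1 # 0 # 1 # alternating n"
      and w': "alternating (length w') = alternating k @ alternating n"
      by (simp_all only: alternating_add alternating_simps)
    show ?thesis
      unfolding w w' l Cap by (simp add: alternating_simps nth_append)
  next
    case (Cross c)
    then have "k + 2 \<le> length w" and w': "length w' = length w"
      using assms by (auto simp: l split: if_splits)
    then obtain n where "length w = k + Suc (Suc n)"
      by (auto simp: le_iff_add)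
    then have w: "alternating (length w) = alternating k @ 0 # 1 # 0 # 1 # alternating n"
      by (simp only: alternating_add alternating_simps)
    show ?thesis
      unfolding w' w l Cross
      by (simp add: recolors_parallel_crossing alternating_simps)
  qed
qed

text \<open>The slices compose because the word between them depends only on the number of strands
  of the original diagram.\<close>

lemma recolors_parallel_slices:
  "pass_slices w s = Some w' \<Longrightarrow>
   recolors (alternating (length w)) (parallel_slices w s) (alternating (length w'))"
  by (induction w s rule: pass_slices.induct)
     (auto simp: recolors_append dest: recolors_parallel_slice split: option.splits)

theorem corollary4p2:
  fixes D :: virtual_link_diagram
  shows "admits_mod2_alexander_numbering (phi_plus D) \<and>
    checkerboard_colorable (welded_link_of (phi_plus D))"
proof -
  have "recolors [] (slices (phi_plus D)) []"
    using recolors_parallel_slices[of "[]" "slices D" "[]"] slices[of D]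
    by (simp add: phi_plus.rep_eq alternating_simps)
  then have "admits_mod2_alexander_numbering (phi_plus D)"
    by (rule admits_numbering_if_recolors)
  then show ?thesis
    unfolding checkerboard_colorable_def by blast
qed

end
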